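(* Given categories $\mathcal C,\mathcal D,\mathcal E$, there is a functor $$F:\mathcal{C}at(\mathcal C,\mathcal D)\times\mathcal{C}at(\mathcal D,\mathcal E)\to\mathcal{C}at(\mathcal C,\mathcal E)$$ given on objects by $F(f,g):=g\circ f$ and on arrows by $F(\tau,\alpha):=\alpha\circ\tau$.
   Context: $\mathcal{C}at(\mathcal C,\mathcal D)$ is the category whose objects are functors $\mathcal C\to\mathcal D$ and whose arrows are natural transformations, with composition $(\sigma\cdot\tau)x:=\sigma x\circ\tau x$. For natural transformations $\tau:f\to h$ of functors $\mathcal C\to\mathcal D$ and $\alpha:g\to i$ of functors $\mathcal D\to\mathcal E$, the natural transformation $\alpha\circ\tau:g\circ f\to i\circ h$ is given by $(\alpha\circ\tau)x:=\alpha(hx)\circ g(\tau x)$ for each object $x$ of $\mathcal C$. *)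

theory Defs
  imports "HOL-Library.FuncSet"
begin

record ('o, 'a) category =
  Ob :: "'o set"
  Ar :: "'a set"
  Dom :: "'a \<Rightarrow> 'o"
  Cod :: "'a \<Rightarrow> 'o"
  Id :: "'o \<Rightarrow> 'a"
  Comp :: "'a \<Rightarrow> 'a \<Rightarrow> 'a"

text \<open>\<open>Comp C b a\<close> is the composite \<open>b \<circ> a\<close> (first \<open>a\<close>, then \<open>b\<close>).  Its value
  is unconstrained unless \<open>a\<close> and \<open>b\<close> are arrows with \<open>Cod C a = Dom C b\<close>.\<close>

locale category =
  fixes C :: "('o, 'a) category"
  assumes Dom_in_Ob: "a \<in> Ar C \<Longrightarrow> Dom C a \<in> Ob C"
    and Cod_in_Ob: "a \<in> Ar C \<Longrightarrow> Cod C a \<in> Ob C"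
    and Id_in_Ar: "x \<in> Ob C \<Longrightarrow> Id C x \<in> Ar C"
    and Dom_Id: "x \<in> Ob C \<Longrightarrow> Dom C (Id C x) = x"
    and Cod_Id: "x \<in> Ob C \<Longrightarrow> Cod C (Id C x) = x"
    and Comp_in_Ar: "\<lbrakk>a \<in> Ar C; b \<in> Ar C; Cod C a = Dom C b\<rbrakk> \<Longrightarrow> Comp C b a \<in> Ar C"
    and Dom_Comp: "\<lbrakk>a \<in> Ar C; b \<in> Ar C; Cod C a = Dom C b\<rbrakk> \<Longrightarrow> Dom C (Comp C b a) = Dom C a"
    and Cod_Comp: "\<lbrakk>a \<in> Ar C; b \<in> Ar C; Cod C a = Dom C b\<rbrakk> \<Longrightarrow> Cod C (Comp C b a) = Cod C b"
    and Comp_Id_right: "a \<in> Ar C \<Longrightarrow> Comp C a (Id C (Dom C a)) = a"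
    and Comp_Id_left: "a \<in> Ar C \<Longrightarrow> Comp C (Id C (Cod C a)) a = a"
    and Comp_assoc: "\<lbrakk>a \<in> Ar C; b \<in> Ar C; c \<in> Ar C; Cod C a = Dom C b; Cod C b = Dom C c\<rbrakk>
      \<Longrightarrow> Comp C c (Comp C b a) = Comp C (Comp C c b) a"

text \<open>The object and arrow maps of functors, and the component maps of natural
  transformations, are required to be extensional (\<open>\<rightarrow>\<^sub>E\<close>), so that HOL equality of
  functors and of natural transformations is equality on the given category.\<close>

record ('o1, 'a1, 'o2, 'a2) functr =
  on_Ob :: "'o1 \<Rightarrow> 'o2"
  on_Ar :: "'a1 \<Rightarrow> 'a2"

locale is_functor = source: category A + target: category B
  for A :: "('o1, 'a1) category" and B :: "('o2, 'a2) category" +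
  fixes F :: "('o1, 'a1, 'o2, 'a2) functr"
  assumes on_Ob_in: "on_Ob F \<in> Ob A \<rightarrow>\<^sub>E Ob B"
    and on_Ar_in: "on_Ar F \<in> Ar A \<rightarrow>\<^sub>E Ar B"
    and on_Ar_Dom: "a \<in> Ar A \<Longrightarrow> Dom B (on_Ar F a) = on_Ob F (Dom A a)"
    and on_Ar_Cod: "a \<in> Ar A \<Longrightarrow> Cod B (on_Ar F a) = on_Ob F (Cod A a)"
    and on_Ar_Id: "x \<in> Ob A \<Longrightarrow> on_Ar F (Id A x) = Id B (on_Ob F x)"
    and on_Ar_Comp: "\<lbrakk>a \<in> Ar A; b \<in> Ar A; Cod A a = Dom A b\<rbrakk>
      \<Longrightarrow> on_Ar F (Comp A b a) = Comp B (on_Ar F b) (on_Ar F a)"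

definition functor_comp ::
  "('o1, 'a1) category \<Rightarrow> ('o2, 'a2, 'o3, 'a3) functr \<Rightarrow> ('o1, 'a1, 'o2, 'a2) functr
    \<Rightarrow> ('o1, 'a1, 'o3, 'a3) functr" where
  "functor_comp C g f =
    \<lparr>on_Ob = (\<lambda>x \<in> Ob C. on_Ob g (on_Ob f x)), on_Ar = (\<lambda>a \<in> Ar C. on_Ar g (on_Ar f a))\<rparr>"

text \<open>A natural transformation carries its domain and codomain functors, as an arrow
  of the functor category must.\<close>

record ('o1, 'a1, 'o2, 'a2) nat_trans =
  nt_dom :: "('o1, 'a1, 'o2, 'a2) functr"
  nt_cod :: "('o1, 'a1, 'o2, 'a2) functr"
  nt_at :: "'o1 \<Rightarrow> 'a2"

locale is_nat_trans =
  dom_functor: is_functor A B "nt_dom \<tau>" + cod_functor: is_functor A B "nt_cod \<tau>"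
  for A :: "('o1, 'a1) category" and B :: "('o2, 'a2) category"
    and \<tau> :: "('o1, 'a1, 'o2, 'a2) nat_trans" +
  assumes nt_at_in: "nt_at \<tau> \<in> Ob A \<rightarrow>\<^sub>E Ar B"
    and nt_at_Dom: "x \<in> Ob A \<Longrightarrow> Dom B (nt_at \<tau> x) = on_Ob (nt_dom \<tau>) x"
    and nt_at_Cod: "x \<in> Ob A \<Longrightarrow> Cod B (nt_at \<tau> x) = on_Ob (nt_cod \<tau>) x"
    and naturality: "a \<in> Ar A \<Longrightarrow>
      Comp B (nt_at \<tau> (Cod A a)) (on_Ar (nt_dom \<tau>) a)
        = Comp B (on_Ar (nt_cod \<tau>) a) (nt_at \<tau> (Dom A a))"

definition functor_category ::
  "('o1, 'a1) category \<Rightarrow> ('o2, 'a2) category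
    \<Rightarrow> (('o1, 'a1, 'o2, 'a2) functr, ('o1, 'a1, 'o2, 'a2) nat_trans) category" where
  "functor_category C D =
    \<lparr>Ob = {f. is_functor C D f},
     Ar = {\<tau>. is_nat_trans C D \<tau>},
     Dom = nt_dom,
     Cod = nt_cod,
     Id = (\<lambda>f. \<lparr>nt_dom = f, nt_cod = f, nt_at = (\<lambda>x \<in> Ob C. Id D (on_Ob f x))\<rparr>),
     Comp = (\<lambda>\<sigma> \<tau>. \<lparr>nt_dom = nt_dom \<tau>, nt_cod = nt_cod \<sigma>,
       nt_at = (\<lambda>x \<in> Ob C. Comp D (nt_at \<sigma> x) (nt_at \<tau> x))\<rparr>)\<rparr>"

definition product_category ::
  "('o1, 'a1) category \<Rightarrow> ('o2, 'a2) category \<Rightarrow> ('o1 \<times> 'o2, 'a1 \<times> 'a2) category" where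
  "product_category A B =
    \<lparr>Ob = Ob A \<times> Ob B,
     Ar = Ar A \<times> Ar B,
     Dom = map_prod (Dom A) (Dom B),
     Cod = map_prod (Cod A) (Cod B),
     Id = map_prod (Id A) (Id B),
     Comp = (\<lambda>(b, b') (a, a'). (Comp A b a, Comp B b' a'))\<rparr>"

text \<open>The composite \<open>\<alpha> \<circ> \<tau>\<close> of \<open>\<tau> : f \<rightarrow> h\<close> and \<open>\<alpha> : g \<rightarrow> i\<close>, with
  \<open>(\<alpha> \<circ> \<tau>) x = \<alpha> (h x) \<circ> g (\<tau> x)\<close>.\<close>

definition horizontal_comp ::
  "('o1, 'a1) category \<Rightarrow> ('o3, 'a3) category
    \<Rightarrow> ('o2, 'a2, 'o3, 'a3) nat_trans \<Rightarrow> ('o1, 'a1, 'o2, 'a2) nat_trans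
    \<Rightarrow> ('o1, 'a1, 'o3, 'a3) nat_trans" where
  "horizontal_comp C E \<alpha> \<tau> =
    \<lparr>nt_dom = functor_comp C (nt_dom \<alpha>) (nt_dom \<tau>),
     nt_cod = functor_comp C (nt_cod \<alpha>) (nt_cod \<tau>),
     nt_at = (\<lambda>x \<in> Ob C.
       Comp E (nt_at \<alpha> (on_Ob (nt_cod \<tau>) x)) (on_Ar (nt_dom \<alpha>) (nt_at \<tau> x)))\<rparr>"

end

theory Submission
  imports Defs
begin

text \<open>
  Everything is checked one object \<open>x\<close> at a time, in the target category.  There the whole
  content reduces to two consequences of associativity: commuting squares may be pasted
  along a common edge (\<open>paste_squares\<close>), and in a composite of four arrows the middle two may be
  exchanged for any other pair with the same composite (\<open>exchange_middle\<close>).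

  Pasting gives naturality of the vertical composite \<open>\<sigma> \<cdot> \<tau>\<close>, and also of \<open>\<alpha> \<circ> \<tau>\<close> for
  \<open>\<tau> : f \<rightarrow> h\<close> and \<open>\<alpha> : g \<rightarrow> i\<close>: the square of \<open>\<alpha> \<circ> \<tau>\<close> at an arrow \<open>a\<close> is the \<open>g\<close>-image of the
  square of \<open>\<tau>\<close> at \<open>a\<close>, pasted to the square of \<open>\<alpha>\<close> at \<open>h a\<close>.

  Functoriality is preservation of identities, which is immediate, and the interchange law
  \<open>(\<beta> \<cdot> \<alpha>) \<circ> (\<sigma> \<cdot> \<tau>) = (\<beta> \<circ> \<sigma>) \<cdot> (\<alpha> \<circ> \<tau>)\<close>.  For \<open>\<sigma> : h \<rightarrow> k\<close> and \<open>\<beta> : i \<rightarrow> j\<close> its two sides have at \<open>x\<close> the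
  components
  \<open>\<beta>(kx) \<circ> \<alpha>(kx) \<circ> g(\<sigma>x) \<circ> g(\<tau>x)\<close> and \<open>\<beta>(kx) \<circ> i(\<sigma>x) \<circ> \<alpha>(hx) \<circ> g(\<tau>x)\<close>, whose middle parts agree
  by naturality of \<open>\<alpha>\<close> at the arrow \<open>\<sigma>x : hx \<rightarrow> kx\<close>.
\<close>

section \<open>Composites of commuting squares\<close>

context category
begin

text \<open>In the applications \<open>f\<close>, \<open>g\<close>, \<open>h\<close> are the images of one arrow under three functors, and
  \<open>t\<close>, \<open>s\<close> are components at its domain and \<open>t'\<close>, \<open>s'\<close> components at its codomain.\<close>

lemma paste_squares:
  assumes "f \<in> Ar C" "g \<in> Ar C" "h \<in> Ar C" "t \<in> Ar C" "t' \<in> Ar C" "s \<in> Ar C" "s' \<in> Ar C"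
    and "Cod C f = Dom C t'" "Cod C t' = Dom C s'" "Cod C t = Dom C g" "Cod C g = Dom C s'"
    and "Cod C t = Dom C s" "Cod C s = Dom C h"
    and left: "Comp C t' f = Comp C g t"
    and right: "Comp C s' g = Comp C h s"
  shows "Comp C (Comp C s' t') f = Comp C h (Comp C s t)"
proof -
  have "Comp C (Comp C s' t') f = Comp C s' (Comp C g t)"
    using assms by (simp add: Comp_assoc[symmetric])
  also have "\<dots> = Comp C (Comp C h s) t"
    using assms by (simp add: Comp_assoc)
  also have "\<dots> = Comp C h (Comp C s t)"
    using assms by (simp add: Comp_assoc)
  finally show ?thesis .
qed

lemma exchange_middle:
  assumes "a \<in> Ar C" "b \<in> Ar C" "c \<in> Ar C" "b' \<in> Ar C" "c' \<in> Ar C" "d \<in> Ar C"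
    and "Cod C a = Dom C b" "Cod C b = Dom C c" "Cod C c = Dom C d"
    and "Cod C a = Dom C b'" "Cod C b' = Dom C c'" "Cod C c' = Dom C d"
    and middle: "Comp C c b = Comp C c' b'"
  shows "Comp C (Comp C d c) (Comp C b a) = Comp C (Comp C d c') (Comp C b' a)"
proof -
  have "Comp C (Comp C d c) (Comp C b a) = Comp C d (Comp C (Comp C c b) a)"
    using assms(1-12) by (simp add: Comp_assoc[symmetric] Comp_in_Ar Dom_Comp Cod_Comp)
  also have "\<dots> = Comp C d (Comp C (Comp C c' b') a)"
    by (simp only: middle)
  also have "\<dots> = Comp C (Comp C d c') (Comp C b' a)"
    using assms(1-12) by (simp add: Comp_assoc[symmetric] Comp_in_Ar Dom_Comp Cod_Comp)
  finally show ?thesis .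
qed

end

section \<open>Product categories and composite functors\<close>

lemma category_product_category:
  assumes "category A" and "category B"
  shows "category (product_category A B)"
proof -
  interpret A: category A by fact
  interpret B: category B by fact
  show ?thesis
    by unfold_locales
      (auto simp: product_category_def
        A.Dom_in_Ob A.Cod_in_Ob A.Id_in_Ar A.Dom_Id A.Cod_Id A.Comp_in_Ar A.Dom_Comp A.Cod_Comp
        A.Comp_Id_right A.Comp_Id_left A.Comp_assoc
        B.Dom_in_Ob B.Cod_in_Ob B.Id_in_Ar B.Dom_Id B.Cod_Id B.Comp_in_Ar B.Dom_Comp B.Cod_Comp
        B.Comp_Id_right B.Comp_Id_left B.Comp_assoc)
qed

context is_functor
begin

lemma on_Ob_mem: "x \<in> Ob A \<Longrightarrow> on_Ob F x \<in> Ob B"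
  using on_Ob_in by auto

lemma on_Ar_mem: "a \<in> Ar A \<Longrightarrow> on_Ar F a \<in> Ar B"
  using on_Ar_in by auto

end

lemma is_functor_functor_comp:
  assumes "is_functor C D f" and "is_functor D E g"
  shows "is_functor C E (functor_comp C g f)"
proof -
  interpret f: is_functor C D f by fact
  interpret g: is_functor D E g by fact
  show ?thesis
    by unfold_locales
      (auto simp: functor_comp_def f.on_Ob_mem f.on_Ar_mem g.on_Ob_mem g.on_Ar_mem
        f.on_Ar_Dom f.on_Ar_Cod f.on_Ar_Id f.on_Ar_Comp
        g.on_Ar_Dom g.on_Ar_Cod g.on_Ar_Id g.on_Ar_Comp
        f.source.Dom_in_Ob f.source.Cod_in_Ob f.source.Id_in_Ar f.source.Comp_in_Ar)
qed

section \<open>The category of functors\<close>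

lemma (in is_nat_trans) nt_at_mem: "x \<in> Ob A \<Longrightarrow> nt_at \<tau> x \<in> Ar B"
  using nt_at_in by auto

text \<open>Component maps are extensional, so values outside \<open>Ob A\<close> cannot distinguish
  two transformations.\<close>

lemma nat_trans_eqI:
  assumes "is_nat_trans A B \<sigma>" and "is_nat_trans A B \<tau>"
    and "nt_dom \<sigma> = nt_dom \<tau>" and "nt_cod \<sigma> = nt_cod \<tau>"
    and "\<And>x. x \<in> Ob A \<Longrightarrow> nt_at \<sigma> x = nt_at \<tau> x"
  shows "\<sigma> = \<tau>"
proof -
  have "nt_at \<sigma> = nt_at \<tau>"
    using is_nat_trans.nt_at_in[OF assms(1)] is_nat_trans.nt_at_in[OF assms(2)] assms(5)
    by (rule PiE_ext)
  with assms(3,4) show ?thesis by simp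
qed

lemma functor_category_simps:
  "Ob (functor_category C D) = {f. is_functor C D f}"
  "Ar (functor_category C D) = {\<tau>. is_nat_trans C D \<tau>}"
  "Dom (functor_category C D) = nt_dom"
  "Cod (functor_category C D) = nt_cod"
  "nt_dom (Id (functor_category C D) f) = f"
  "nt_cod (Id (functor_category C D) f) = f"
  "x \<in> Ob C \<Longrightarrow> nt_at (Id (functor_category C D) f) x = Id D (on_Ob f x)"
  "nt_dom (Comp (functor_category C D) \<sigma> \<tau>) = nt_dom \<tau>"
  "nt_cod (Comp (functor_category C D) \<sigma> \<tau>) = nt_cod \<sigma>"
  "x \<in> Ob C \<Longrightarrow>
    nt_at (Comp (functor_category C D) \<sigma> \<tau>) x = Comp D (nt_at \<sigma> x) (nt_at \<tau> x)"
  by (simp_all add: functor_category_def)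

lemma is_nat_trans_Id:
  assumes "is_functor C D f"
  shows "is_nat_trans C D (Id (functor_category C D) f)"
proof -
  interpret f: is_functor C D f by fact
  have "nt_at (Id (functor_category C D) f) \<in> Ob C \<rightarrow>\<^sub>E Ar D"
    by (auto simp: functor_category_def f.on_Ob_mem f.target.Id_in_Ar)
  moreover have "Comp D (Id D (on_Ob f (Cod C a))) (on_Ar f a)
      = Comp D (on_Ar f a) (Id D (on_Ob f (Dom C a)))" if "a \<in> Ar C" for a
    using that f.target.Comp_Id_left[OF f.on_Ar_mem] f.target.Comp_Id_right[OF f.on_Ar_mem]
    by (simp add: f.on_Ar_Dom f.on_Ar_Cod)
  ultimately show ?thesis
    using assms
    by (auto simp: is_nat_trans_def is_nat_trans_axioms_def functor_category_simps
        f.on_Ob_mem f.target.Dom_Id f.target.Cod_Id f.source.Dom_in_Ob f.source.Cod_in_Ob)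
qed

lemma is_nat_trans_Comp:
  assumes "is_nat_trans C D \<tau>" and "is_nat_trans C D \<sigma>" and eq: "nt_cod \<tau> = nt_dom \<sigma>"
  shows "is_nat_trans C D (Comp (functor_category C D) \<sigma> \<tau>)"
proof -
  interpret t: is_nat_trans C D \<tau> by fact
  interpret s: is_nat_trans C D \<sigma> by fact
  note D = t.dom_functor.target.category_axioms
  note comp = eq s.nt_at_mem t.nt_at_mem s.nt_at_Dom s.nt_at_Cod t.nt_at_Dom t.nt_at_Cod
  have "nt_at (Comp (functor_category C D) \<sigma> \<tau>) \<in> Ob C \<rightarrow>\<^sub>E Ar D"
    by (auto simp: functor_category_def comp intro!: category.Comp_in_Ar[OF D])
  moreover have "Comp D (Comp D (nt_at \<sigma> (Cod C a)) (nt_at \<tau> (Cod C a))) (on_Ar (nt_dom \<tau>) a)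
      = Comp D (on_Ar (nt_cod \<sigma>) a) (Comp D (nt_at \<sigma> (Dom C a)) (nt_at \<tau> (Dom C a)))"
    if a: "a \<in> Ar C" for a
  proof (rule category.paste_squares[OF D])
    show "Comp D (nt_at \<tau> (Cod C a)) (on_Ar (nt_dom \<tau>) a)
        = Comp D (on_Ar (nt_dom \<sigma>) a) (nt_at \<tau> (Dom C a))"
      using t.naturality[OF a] by (simp add: eq)
    show "Comp D (nt_at \<sigma> (Cod C a)) (on_Ar (nt_dom \<sigma>) a)
        = Comp D (on_Ar (nt_cod \<sigma>) a) (nt_at \<sigma> (Dom C a))"
      by (rule s.naturality[OF a])
  qed (use a in \<open>simp_all add: comp t.dom_functor.source.Dom_in_Ob t.dom_functor.source.Cod_in_Ob
      t.dom_functor.on_Ar_mem s.dom_functor.on_Ar_mem s.cod_functor.on_Ar_mem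
      t.dom_functor.on_Ar_Cod s.dom_functor.on_Ar_Dom s.dom_functor.on_Ar_Cod
      s.cod_functor.on_Ar_Dom\<close>)
  ultimately show ?thesis
    using t.dom_functor.is_functor_axioms s.cod_functor.is_functor_axioms
    by (auto simp: is_nat_trans_def is_nat_trans_axioms_def functor_category_simps comp
        category.Dom_Comp[OF D] category.Cod_Comp[OF D]
        t.dom_functor.source.Dom_in_Ob t.dom_functor.source.Cod_in_Ob)
qed

lemma category_functor_category: "category (functor_category C D)"
proof
  fix \<tau> assume "\<tau> \<in> Ar (functor_category C D)"
  then interpret t: is_nat_trans C D \<tau> by (simp add: functor_category_simps)
  note [simp] = functor_category_simps
  note D = t.dom_functor.target.category_axioms
  show "Dom (functor_category C D) \<tau> \<in> Ob (functor_category C D)"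
    using t.dom_functor.is_functor_axioms by simp
  show "Cod (functor_category C D) \<tau> \<in> Ob (functor_category C D)"
    using t.cod_functor.is_functor_axioms by simp
  show "Comp (functor_category C D) \<tau> (Id (functor_category C D) (Dom (functor_category C D) \<tau>)) = \<tau>"
  proof (rule nat_trans_eqI[of C D])
    fix x assume "x \<in> Ob C"
    then show "nt_at (Comp (functor_category C D) \<tau>
        (Id (functor_category C D) (Dom (functor_category C D) \<tau>))) x = nt_at \<tau> x"
      using category.Comp_Id_right[OF D t.nt_at_mem] by (simp add: t.nt_at_Dom)
  qed (simp_all add: is_nat_trans_Comp is_nat_trans_Id t.is_nat_trans_axioms
      t.dom_functor.is_functor_axioms)
  show "Comp (functor_category C D) (Id (functor_category C D) (Cod (functor_category C D) \<tau>)) \<tau> = \<tau>"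
  proof (rule nat_trans_eqI[of C D])
    fix x assume "x \<in> Ob C"
    then show "nt_at (Comp (functor_category C D)
        (Id (functor_category C D) (Cod (functor_category C D) \<tau>)) \<tau>) x = nt_at \<tau> x"
      using category.Comp_Id_left[OF D t.nt_at_mem] by (simp add: t.nt_at_Cod)
  qed (simp_all add: is_nat_trans_Comp is_nat_trans_Id t.is_nat_trans_axioms
      t.cod_functor.is_functor_axioms)
next
  fix \<tau> \<sigma> \<rho>
  assume "\<tau> \<in> Ar (functor_category C D)" "\<sigma> \<in> Ar (functor_category C D)"
    "\<rho> \<in> Ar (functor_category C D)"
    and "Cod (functor_category C D) \<tau> = Dom (functor_category C D) \<sigma>"
    and "Cod (functor_category C D) \<sigma> = Dom (functor_category C D) \<rho>"
  then have nt: "is_nat_trans C D \<tau>" "is_nat_trans C D \<sigma>" "is_nat_trans C D \<rho>"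
    and eq: "nt_cod \<tau> = nt_dom \<sigma>" "nt_cod \<sigma> = nt_dom \<rho>"
    by (simp_all add: functor_category_simps)
  interpret t: is_nat_trans C D \<tau> by fact
  interpret s: is_nat_trans C D \<sigma> by fact
  interpret r: is_nat_trans C D \<rho> by fact
  show "Comp (functor_category C D) \<rho> (Comp (functor_category C D) \<sigma> \<tau>)
      = Comp (functor_category C D) (Comp (functor_category C D) \<rho> \<sigma>) \<tau>"
    by (rule nat_trans_eqI[of C D])
      (simp_all add: functor_category_simps is_nat_trans_Comp nt eq
        t.dom_functor.target.Comp_assoc t.nt_at_mem s.nt_at_mem r.nt_at_mem
        t.nt_at_Cod s.nt_at_Dom s.nt_at_Cod r.nt_at_Dom)
qed (simp_all add: functor_category_simps is_nat_trans_Id is_nat_trans_Comp)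

section \<open>Horizontal composition and the interchange law\<close>

lemma horizontal_comp_simps:
  "nt_dom (horizontal_comp C E \<alpha> \<tau>) = functor_comp C (nt_dom \<alpha>) (nt_dom \<tau>)"
  "nt_cod (horizontal_comp C E \<alpha> \<tau>) = functor_comp C (nt_cod \<alpha>) (nt_cod \<tau>)"
  "x \<in> Ob C \<Longrightarrow> nt_at (horizontal_comp C E \<alpha> \<tau>) x
    = Comp E (nt_at \<alpha> (on_Ob (nt_cod \<tau>) x)) (on_Ar (nt_dom \<alpha>) (nt_at \<tau> x))"
  by (simp_all add: horizontal_comp_def)

text \<open>The left-hand square to be pasted commutes because the functor \<open>nt_dom \<alpha>\<close> preserves the
  naturality square of \<open>\<tau>\<close>; the right-hand one is naturality of \<open>\<alpha>\<close>, at the image of the given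
  arrow under \<open>nt_cod \<tau>\<close>.\<close>

lemma is_nat_trans_horizontal_comp:
  assumes "is_nat_trans C D \<tau>" and "is_nat_trans D E \<alpha>"
  shows "is_nat_trans C E (horizontal_comp C E \<alpha> \<tau>)"
proof -
  interpret t: is_nat_trans C D \<tau> by fact
  interpret a: is_nat_trans D E \<alpha> by fact
  note E = a.dom_functor.target.category_axioms
  note mem = t.nt_at_mem a.nt_at_mem t.dom_functor.on_Ob_mem t.cod_functor.on_Ob_mem
    t.dom_functor.on_Ar_mem t.cod_functor.on_Ar_mem
    a.dom_functor.on_Ar_mem a.cod_functor.on_Ar_mem
    t.dom_functor.source.Dom_in_Ob t.dom_functor.source.Cod_in_Ob
  note ends = t.nt_at_Dom t.nt_at_Cod a.nt_at_Dom a.nt_at_Cod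
    t.dom_functor.on_Ar_Dom t.dom_functor.on_Ar_Cod
    t.cod_functor.on_Ar_Dom t.cod_functor.on_Ar_Cod
    a.dom_functor.on_Ar_Dom a.dom_functor.on_Ar_Cod
    a.cod_functor.on_Ar_Dom a.cod_functor.on_Ar_Cod
  have "nt_at (horizontal_comp C E \<alpha> \<tau>) \<in> Ob C \<rightarrow>\<^sub>E Ar E"
    by (auto simp: horizontal_comp_def mem ends intro!: category.Comp_in_Ar[OF E])
  moreover have "Comp E (nt_at (horizontal_comp C E \<alpha> \<tau>) (Cod C u))
        (on_Ar (functor_comp C (nt_dom \<alpha>) (nt_dom \<tau>)) u)
      = Comp E (on_Ar (functor_comp C (nt_cod \<alpha>) (nt_cod \<tau>)) u)
        (nt_at (horizontal_comp C E \<alpha> \<tau>) (Dom C u))"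
    if u: "u \<in> Ar C" for u
  proof -
    have "Comp E (Comp E (nt_at \<alpha> (on_Ob (nt_cod \<tau>) (Cod C u)))
          (on_Ar (nt_dom \<alpha>) (nt_at \<tau> (Cod C u)))) (on_Ar (nt_dom \<alpha>) (on_Ar (nt_dom \<tau>) u))
        = Comp E (on_Ar (nt_cod \<alpha>) (on_Ar (nt_cod \<tau>) u))
          (Comp E (nt_at \<alpha> (on_Ob (nt_cod \<tau>) (Dom C u))) (on_Ar (nt_dom \<alpha>) (nt_at \<tau> (Dom C u))))"
    proof (rule category.paste_squares[OF E])
      show "Comp E (on_Ar (nt_dom \<alpha>) (nt_at \<tau> (Cod C u))) (on_Ar (nt_dom \<alpha>) (on_Ar (nt_dom \<tau>) u))
          = Comp E (on_Ar (nt_dom \<alpha>) (on_Ar (nt_cod \<tau>) u)) (on_Ar (nt_dom \<alpha>) (nt_at \<tau> (Dom C u)))"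
        using u t.naturality[OF u] by (simp add: mem ends a.dom_functor.on_Ar_Comp[symmetric])
      show "Comp E (nt_at \<alpha> (on_Ob (nt_cod \<tau>) (Cod C u))) (on_Ar (nt_dom \<alpha>) (on_Ar (nt_cod \<tau>) u))
          = Comp E (on_Ar (nt_cod \<alpha>) (on_Ar (nt_cod \<tau>) u)) (nt_at \<alpha> (on_Ob (nt_cod \<tau>) (Dom C u)))"
        using u a.naturality[of "on_Ar (nt_cod \<tau>) u"] by (simp add: mem ends)
    qed (use u in \<open>simp_all add: mem ends\<close>)
    then show ?thesis
      using u by (simp add: horizontal_comp_simps functor_comp_def mem)
  qed
  ultimately show ?thesis
    using is_functor_functor_comp[OF t.dom_functor.is_functor_axioms a.dom_functor.is_functor_axioms]
      is_functor_functor_comp[OF t.cod_functor.is_functor_axioms a.cod_functor.is_functor_axioms]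
    by (auto simp: is_nat_trans_def is_nat_trans_axioms_def horizontal_comp_simps mem ends
        functor_comp_def category.Dom_Comp[OF E] category.Cod_Comp[OF E])
qed

lemma horizontal_comp_Id:
  assumes "is_functor C D f" and "is_functor D E g"
  shows "horizontal_comp C E (Id (functor_category D E) g) (Id (functor_category C D) f)
    = Id (functor_category C E) (functor_comp C g f)"
proof -
  interpret f: is_functor C D f by fact
  interpret g: is_functor D E g by fact
  have "Comp E (Id E y) (Id E y) = Id E y" if "y \<in> Ob E" for y
    using that g.target.Comp_Id_left[OF g.target.Id_in_Ar] by (simp add: g.target.Cod_Id)
  then have "nt_at (horizontal_comp C E (Id (functor_category D E) g) (Id (functor_category C D) f)) x
      = nt_at (Id (functor_category C E) (functor_comp C g f)) x" if "x \<in> Ob C" for x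
    using that
    by (simp add: horizontal_comp_simps functor_category_simps functor_comp_def
        f.on_Ob_mem g.on_Ob_mem g.on_Ar_Id)
  then show ?thesis
    using assms
    by (intro nat_trans_eqI[of C E])
      (simp_all add: horizontal_comp_simps functor_category_simps
        is_nat_trans_horizontal_comp[of C D _ E] is_nat_trans_Id is_functor_functor_comp)
qed

text \<open>The interchange law.  At \<open>x\<close>, both sides start with the image of \<open>nt_at \<tau> x\<close> under \<open>nt_dom \<alpha>\<close>
  and end with the component of \<open>\<beta>\<close> at \<open>on_Ob (nt_cod \<sigma>) x\<close>; in between they go round opposite
  sides of the naturality square of \<open>\<alpha>\<close> at the arrow \<open>nt_at \<sigma> x\<close>.\<close>

lemma horizontal_comp_Comp:
  assumes nt: "is_nat_trans C D \<tau>" "is_nat_trans C D \<sigma>" "is_nat_trans D E \<alpha>" "is_nat_trans D E \<beta>"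
    and eq: "nt_cod \<tau> = nt_dom \<sigma>" "nt_cod \<alpha> = nt_dom \<beta>"
  shows "horizontal_comp C E (Comp (functor_category D E) \<beta> \<alpha>) (Comp (functor_category C D) \<sigma> \<tau>)
    = Comp (functor_category C E) (horizontal_comp C E \<beta> \<sigma>) (horizontal_comp C E \<alpha> \<tau>)"
proof (rule nat_trans_eqI[of C E])
  interpret t: is_nat_trans C D \<tau> by fact
  interpret s: is_nat_trans C D \<sigma> by fact
  interpret a: is_nat_trans D E \<alpha> by fact
  interpret b: is_nat_trans D E \<beta> by fact
  note mem = t.nt_at_mem s.nt_at_mem a.nt_at_mem b.nt_at_mem
    s.dom_functor.on_Ob_mem s.cod_functor.on_Ob_mem
    a.dom_functor.on_Ar_mem b.dom_functor.on_Ar_mem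
  note ends = eq t.nt_at_Dom t.nt_at_Cod s.nt_at_Dom s.nt_at_Cod
    a.nt_at_Dom a.nt_at_Cod b.nt_at_Dom b.nt_at_Cod
    a.dom_functor.on_Ar_Dom a.dom_functor.on_Ar_Cod
    b.dom_functor.on_Ar_Dom b.dom_functor.on_Ar_Cod
  fix x assume x: "x \<in> Ob C"
  let ?h = "on_Ob (nt_dom \<sigma>) x" and ?k = "on_Ob (nt_cod \<sigma>) x"
  have "Comp E (Comp E (nt_at \<beta> ?k) (nt_at \<alpha> ?k))
        (Comp E (on_Ar (nt_dom \<alpha>) (nt_at \<sigma> x)) (on_Ar (nt_dom \<alpha>) (nt_at \<tau> x)))
      = Comp E (Comp E (nt_at \<beta> ?k) (on_Ar (nt_dom \<beta>) (nt_at \<sigma> x)))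
        (Comp E (nt_at \<alpha> ?h) (on_Ar (nt_dom \<alpha>) (nt_at \<tau> x)))"
  proof (rule a.dom_functor.target.exchange_middle)
    show "Comp E (nt_at \<alpha> ?k) (on_Ar (nt_dom \<alpha>) (nt_at \<sigma> x))
        = Comp E (on_Ar (nt_dom \<beta>) (nt_at \<sigma> x)) (nt_at \<alpha> ?h)"
      using x a.naturality[of "nt_at \<sigma> x"] by (simp add: mem ends)
  qed (use x in \<open>simp_all add: mem ends\<close>)
  then show "nt_at (horizontal_comp C E (Comp (functor_category D E) \<beta> \<alpha>)
        (Comp (functor_category C D) \<sigma> \<tau>)) x
      = nt_at (Comp (functor_category C E) (horizontal_comp C E \<beta> \<sigma>) (horizontal_comp C E \<alpha> \<tau>)) x"
    using x
    by (simp add: horizontal_comp_simps functor_category_simps mem ends a.dom_functor.on_Ar_Comp)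
qed (simp_all add: horizontal_comp_simps functor_category_simps nt eq
    is_nat_trans_Comp is_nat_trans_horizontal_comp[of C D _ E])

section \<open>The composition functor\<close>

theorem theorem5p21:
  fixes C :: "('o1, 'a1) category"
    and D :: "('o2, 'a2) category"
    and E :: "('o3, 'a3) category"
  assumes "category C" and "category D" and "category E"
  shows "\<exists>F. is_functor (product_category (functor_category C D) (functor_category D E))
              (functor_category C E) F
          \<and> (\<forall>f \<in> Ob (functor_category C D). \<forall>g \<in> Ob (functor_category D E).
                on_Ob F (f, g) = functor_comp C g f)
          \<and> (\<forall>\<tau> \<in> Ar (functor_category C D). \<forall>\<alpha> \<in> Ar (functor_category D E).
                on_Ar F (\<tau>, \<alpha>) = horizontal_comp C E \<alpha> \<tau>)"
proof -
  let ?P = "product_category (functor_category C D) (functor_category D E)"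
  define F where "F = \<lparr>on_Ob = (\<lambda>(f, g) \<in> Ob ?P. functor_comp C g f),
    on_Ar = (\<lambda>(\<tau>, \<alpha>) \<in> Ar ?P. horizontal_comp C E \<alpha> \<tau>)\<rparr>"
  interpret P: category ?P
    by (intro category_product_category category_functor_category)
  have Ob: "on_Ob F (f, g) = functor_comp C g f" if "is_functor C D f" "is_functor D E g" for f g
    using that by (simp add: F_def product_category_def functor_category_simps)
  have Ar: "on_Ar F (\<tau>, \<alpha>) = horizontal_comp C E \<alpha> \<tau>"
    if "is_nat_trans C D \<tau>" "is_nat_trans D E \<alpha>" for \<tau> \<alpha>
    using that by (simp add: F_def product_category_def functor_category_simps)
  have "is_functor ?P (functor_category C E) F"
  proof (intro is_functor.intro is_functor_axioms.intro P.category_axioms category_functor_category)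
    show "on_Ob F \<in> Ob ?P \<rightarrow>\<^sub>E Ob (functor_category C E)"
      by (auto simp: F_def product_category_def functor_category_simps is_functor_functor_comp)
    show "on_Ar F \<in> Ar ?P \<rightarrow>\<^sub>E Ar (functor_category C E)"
      by (auto simp: F_def product_category_def functor_category_simps is_nat_trans_horizontal_comp)
  qed (auto simp: product_category_def functor_category_simps Ob Ar horizontal_comp_simps
      is_nat_trans.axioms(1,2) is_nat_trans_Id is_nat_trans_Comp
      horizontal_comp_Id horizontal_comp_Comp)
  with Ob Ar show ?thesis
    by (auto simp: functor_category_simps)
qed

end
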